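(* Let $r>0$ be an integer and let $\eta>0$, $0<\eta'<1$ be reals. Let $\mathcal C\subseteq\Sigma^n$, $\Sigma=\mathbb F_q^s$, be a $\tau$-subspace-design $\mathbb F_q$-additive code, let $L_1,\dots,L_n\subseteq\Sigma$ with $|L_i|=\ell$, and let $\mathcal H\subseteq\mathcal C$ be an $\mathbb F_q$-linear space of dimension $r$. Then $$\left|\left\{c\in\mathcal H\;\Big|\;\Delta(c,L_1\times L_2\times\cdots\times L_n)<1-\frac{\tau(r)+\eta}{1-\eta'}\right\}\right|\le \ell^{\,\min\left(r,\ \frac1{\eta'}\left(1+\log(r\eta')\right)\right)}\left(\frac r\eta+1\right).$$
   Context: $\mathbb F_q$ is a finite field, $s\ge1$ an integer, $\Sigma=\mathbb F_q^s$; an $\mathbb F_q$-additive code is an $\mathbb F_q$-linear subspace $\mathcal C\subseteq\Sigma^n$. $\log$ is the natural logarithm. Fractional Hamming distance: $\Delta(x,y)=|\{i\in[n]:x_i\ne y_i\}|/n$ and $\Delta(x,S)=\min_{y\in S}\Delta(x,y)$. Thus $\Delta(c,L_1\times\cdots\times L_n)=|\{i: c_i\notin L_i\}|/n$. For a function $\tau:\mathbb N\to\mathbb R_{\le1}$ (with $\mathbb N$ the positive integers), $\mathcal C\subseteq(\mathbb F_q^s)^n$ is a $\tau$-subspace-design code if for every $r\in\mathbb N$ and every $\mathbb F_q$-linear subspace $\mathcal A\subseteq\mathcal C$ of dimension at most $r$, $\frac1n\sum_{i=1}^n\dim\mathcal A_i\le\dim(\mathcal A)\cdot\tau(r)$,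 where $\mathcal A_i=\{a\in\mathcal A: a_i=0\}$.
   Formalization: In the exponent, log(rη') is replaced by max(0, log(rη')): unchanged when rη' ≥ 1, and the exponent is r when rη' < 1, where the literal bound is false (e.g. binary repetition code, τ=0, L_i=F_2, r=1, η=1/2, η'=1/100). *)

theory Defs
  imports "HOL-Analysis.Analysis"
begin

text \<open>
  A word of length \<open>n = CARD('n)\<close> over the alphabet \<open>\<Sigma> = F\<^sub>q\<^sup>s\<close>, \<open>s = CARD('s)\<close>, has type
  \<^typ>\<open>'a^'s^'n\<close>, where \<^typ>\<open>'a\<close> is the field \<open>F\<^sub>q\<close>. The library operation \<open>*s\<close> on this type
  would multiply by a vector of \<^typ>\<open>'a^'s\<close>, so the \<open>F\<^sub>q\<close>-vector space structure is
  introduced here.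
\<close>

definition word_scale :: "'a::field \<Rightarrow> 'a^'s^'n \<Rightarrow> 'a^'s^'n" where
  "word_scale a x = (\<chi> i. a *s (x $ i))"

global_interpretation word: vector_space "word_scale :: 'a::field \<Rightarrow> 'a^'s^'n \<Rightarrow> 'a^'s^'n"
  by unfold_locales (simp_all add: word_scale_def vec_eq_iff algebra_simps)

definition additive_code :: "('a::field^'s^'n) set \<Rightarrow> bool" where
  "additive_code C \<longleftrightarrow> word.subspace C"

definition frac_dist :: "'b^'n \<Rightarrow> 'b^'n \<Rightarrow> real" where
  "frac_dist x y = real (card {i. x $ i \<noteq> y $ i}) / real CARD('n)"

text \<open>
  The minimum over the empty set is not determined by the usual definition; it is set to the
  largest possible distance \<open>1\<close>. This agrees with the formula of \<open>frac_dist_set_list_product\<close>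
  below when all lists are empty.
\<close>

definition frac_dist_set :: "'b::finite^'n \<Rightarrow> ('b^'n) set \<Rightarrow> real" where
  "frac_dist_set x S = (if S = {} then 1 else Min (frac_dist x ` S))"

definition list_product :: "('n \<Rightarrow> 'b set) \<Rightarrow> ('b^'n) set" where
  "list_product L = {y. \<forall>i. y $ i \<in> L i}"

text \<open>
  The domain of \<open>\<tau>\<close> is the set of positive integers; its value at \<open>0\<close> is never used.
\<close>

definition subspace_design_code :: "(nat \<Rightarrow> real) \<Rightarrow> ('a::field^'s^'n) set \<Rightarrow> bool" where
  "subspace_design_code \<tau> C \<longleftrightarrow>
     (\<forall>r\<ge>1. \<forall>A. word.subspace A \<and> A \<subseteq> C \<and> word.dim A \<le> r \<longrightarrow>
        (\<Sum>i\<in>UNIV. real (word.dim {a \<in> A. a $ i = 0})) / real CARD('n)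
          \<le> real (word.dim A) * \<tau> r)"

text \<open>
  The logarithm in the exponent of the list size bound is truncated at \<open>0\<close>: it is meant for
  \<open>r\<eta>' \<ge> 1\<close>, where the truncation has no effect, while for \<open>r\<eta>' \<le> 1\<close> the minimum with \<open>r\<close> is to be
  \<open>r\<close>. Without truncation \<open>(1 + ln (r\<eta>')) / \<eta>' \<le> r\<close> would always hold, and this quantity tends to
  \<open>-\<infinity>\<close> as \<open>\<eta>'\<close> tends to \<open>0\<close>, so that the bound would be false.
\<close>

definition ln_trunc :: "real \<Rightarrow> real" where
  "ln_trunc x = max 0 (ln x)"

lemma ln_trunc_eq_ln: "x \<ge> 1 \<Longrightarrow> ln_trunc x = ln x"
  by (simp add: ln_trunc_def)

lemma frac_dist_set_list_product:
  fixes c :: "'b::finite^'n"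
  assumes "(\<forall>i. L i \<noteq> {}) \<or> (\<forall>i. L i = {})"
  shows "frac_dist_set c (list_product L) = real (card {i. c $ i \<notin> L i}) / real CARD('n)"
proof (cases "\<forall>i. L i \<noteq> {}")
  case True
  define y where "y = (\<chi> i. if c $ i \<in> L i then c $ i else (SOME z. z \<in> L i))"
  have y: "y \<in> list_product L"
    using True by (auto simp: y_def list_product_def some_in_eq)
  have "{i. c $ i \<noteq> y $ i} = {i. c $ i \<notin> L i}"
    using True by (auto simp: y_def) (metis some_in_eq)
  then have d: "frac_dist c y = real (card {i. c $ i \<notin> L i}) / real CARD('n)"
    by (simp add: frac_dist_def)
  have "Min (frac_dist c ` list_product L) = frac_dist c y"
  proof (rule Min_eqI)
    fix t assume "t \<in> frac_dist c ` list_product L"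
    then obtain z where z: "z \<in> list_product L" "t = frac_dist c z" by auto
    have "card {i. c $ i \<notin> L i} \<le> card {i. c $ i \<noteq> z $ i}"
      using z(1) by (intro card_mono) (auto simp: list_product_def)
    then show "frac_dist c y \<le> t"
      unfolding d unfolding z(2) frac_dist_def by (simp add: divide_right_mono)
  qed (use y in auto)
  then show ?thesis using d y by (auto simp: frac_dist_set_def)
next
  case False
  with assms have "\<forall>i. L i = {}" by blast
  then show ?thesis by (simp add: frac_dist_set_def list_product_def)
qed

end

theory Submission
  imports Defs
begin

text \<open>
  Fix a coordinate \<open>i\<close> and a symbol \<open>v \<in> L i\<close>. Two codewords of a coset of \<open>A\<close> which both have the
  symbol \<open>v\<close> at \<open>i\<close> differ by an element of \<open>A\<^sub>i\<close>, so a bound for the cosets of smaller spaces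
  gives, after summation over \<open>v\<close>, a bound with one more factor \<open>l\<close>. Call \<open>i\<close> good if
  \<open>dim A\<^sub>i \<le> (1 - \<eta>') dim A\<close>. The subspace design property and Markov's inequality bound the fraction
  of bad coordinates by \<open>\<tau> r / (1 - \<eta>')\<close>, so each codeword of the list agrees with \<open>L\<close> in many good
  coordinates. Counting these agreements in two ways closes an induction on \<open>dim A\<close>: the factor
  \<open>dim A / \<eta> + 1\<close> is linear in the dimension, so it can be averaged by the subspace design
  property, and at a good coordinate the exponent drops by at least \<open>1\<close>, which pays for the
  factor \<open>l\<close>.
\<close>

definition list_exponent :: "real \<Rightarrow> nat \<Rightarrow> real" where
  "list_exponent h k = min (real k) (1 / h * (1 + ln_trunc (real k * h)))"

text \<open>With the logarithm truncated, the second argument of the minimum is at least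
  \<open>1 / h\<close>, hence at least \<open>k\<close>. The case \<open>k = 0\<close> starts the
  induction on the dimension.\<close>

lemma list_exponent_small:
  assumes "0 < h" "real k * h \<le> 1"
  shows "list_exponent h k = real k"
proof -
  have "real k \<le> 1 / h"
    using assms by (simp add: field_simps)
  also have "\<dots> \<le> 1 / h * (1 + ln_trunc (real k * h))"
    using assms by (simp add: ln_trunc_def field_simps)
  finally show ?thesis
    by (simp add: list_exponent_def)
qed

text \<open>The inequality \<open>ln x \<le> x - 1\<close> at \<open>x = k * h\<close> decides the
  minimum.\<close>

lemma list_exponent_large:
  assumes "0 < h" "1 \<le> real k * h"
  shows "list_exponent h k = (1 + ln (real k * h)) / h"
proof -
  have "1 + ln (real k * h) \<le> real k * h"
    using ln_le_minus_one[of "real k * h"] assms by linarith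
  then show ?thesis
    using assms by (simp add: list_exponent_def ln_trunc_eq_ln min_def field_simps)
qed

text \<open>
  \<open>list_exponent h\<close> is concave, with slope \<open>1 / (h k)\<close> at \<open>k \<ge> 1 / h\<close>. The three cases avoid
  proving concavity.
\<close>

lemma list_exponent_step:
  assumes h: "0 < h" "h < 1" and k: "0 < k" and j: "real j \<le> (1 - h) * real k"
  shows "1 + list_exponent h j \<le> list_exponent h k"
proof -
  have jk: "j < k"
  proof -
    have "(1 - h) * real k < real k" using h k by simp
    with j show ?thesis by linarith
  qed
  consider "real k * h \<le> 1" | "1 \<le> real j * h" | "1 < real k * h" "real j * h < 1"
    by linarith
  then show ?thesis
  proof cases
    case 1
    moreover have "real j * h \<le> 1"
      using 1 jk h mult_right_mono[of "real j" "real k" h] by linarith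
    ultimately show ?thesis
      using h jk by (simp add: list_exponent_small)
  next
    case 2
    then have j0: "0 < real j" by (cases j) auto
    have kh: "1 \<le> real k * h" using 2 jk h mult_right_mono[of "real j" "real k" h] by linarith
    \<comment> \<open>Shrinking \<open>k\<close> by the factor \<open>1 - h\<close> lowers the
      logarithm by at least \<open>h\<close>, hence the exponent by at least 1.\<close>
    have "ln (real j * h) \<le> ln ((1 - h) * (real k * h))"
      using j j0 h by (simp add: mult_right_mono flip: mult.assoc)
    also have "\<dots> = ln (1 - h) + ln (real k * h)"
      using h kh by (intro ln_mult_pos) auto
    also have "ln (1 - h) \<le> - h"
      using ln_le_minus_one[of "1 - h"] h by linarith
    finally have "(h + (1 + ln (real j * h))) / h \<le> (1 + ln (real k * h)) / h"
      using h by (intro divide_right_mono) auto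
    then show ?thesis
      using h list_exponent_large[OF h(1) 2] list_exponent_large[OF h(1) kh]
      by (simp add: add_divide_distrib)
  next
    case 3
    define x y where "x = real j * h" and "y = real k * h"
    have y: "1 < y" and x: "x < 1" using 3 by (simp_all add: x_def y_def)
    have xy: "x \<le> (1 - h) * y"
      using j h by (simp add: x_def y_def mult_right_mono flip: mult.assoc)
    \<comment> \<open>This is the claim times \<open>h\<close>, with the linear formula for
      \<open>j\<close> and the logarithmic one for \<open>k\<close>.\<close>
    have "h + x \<le> 1 + ln y"
    proof (cases "x \<le> 1 - h")
      case True
      with y show ?thesis using ln_ge_zero[of y] by linarith
    next
      case False
      then have x0: "0 < x" using h by linarith
      have "1 - (1 - h) / x \<le> 1 - 1 / y"
        using xy x0 y by (simp add: field_simps)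
      also have "\<dots> \<le> ln y"
        using ln_le_minus_one[of "1 / y"] y by (simp add: ln_div)
      finally have 1: "1 - (1 - h) / x \<le> ln y" .
      \<comment> \<open>After multiplication by \<open>x\<close>, the bound
        \<open>h + x \<le> 2 - (1 - h) / x\<close> is a quadratic inequality with roots
        \<open>1 - h\<close> and 1, and \<open>x\<close> lies between them.\<close>
      have "0 \<le> (1 - x) * (x - (1 - h))"
        using x False by (intro mult_nonneg_nonneg) auto
      then have "(h + x) * x \<le> 2 * x - (1 - h)"
        by (simp add: algebra_simps)
      then have "h + x \<le> 2 - (1 - h) / x"
        using x0 by (simp add: field_simps)
      with 1 show ?thesis by linarith
    qed
    then have "1 + real j \<le> (1 + ln y) / h"
      using h by (simp add: x_def field_simps)
    then show ?thesis
      using 3 h by (simp add: list_exponent_small list_exponent_large y_def)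
  qed
qed

lemma dim_word_eq_0:
  fixes A :: "('a::{field,finite}^'s::finite^'n::finite) set"
  assumes "word.dim A = 0"
  shows "A \<subseteq> {0}"
proof -
  obtain B where "A \<subseteq> word.span B" "card B = word.dim A"
    by (rule word.basis_exists[of A])
  with assms show ?thesis by simp
qed

lemma subspace_vanishing:
  assumes "word.subspace A"
  shows "word.subspace {a \<in> A. a $ i = 0}"
  using assms by (auto simp: word.subspace_def word_scale_def)

text \<open>The design inequality for a nonzero subspace bounds a nonnegative average by a positive
  multiple of \<open>\<tau> r\<close>.\<close>

lemma subspace_design_nonneg:
  fixes A :: "('a::field^'s^'n::finite) set"
  assumes "subspace_design_code \<tau> C" "word.subspace A" "A \<subseteq> C" "0 < word.dim A" "word.dim A \<le> r"
  shows "0 \<le> \<tau> r"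
proof -
  let ?S = "\<Sum>i\<in>UNIV. real (word.dim {a \<in> A. a $ i = 0})"
  have "0 \<le> ?S / real CARD('n)"
    by (simp add: sum_nonneg)
  also have "\<dots> \<le> real (word.dim A) * \<tau> r"
    using assms unfolding subspace_design_code_def by force
  finally show ?thesis
    using assms(4) by (simp add: zero_le_mult_iff)
qed

lemma card_Compl_real: "real (card (- A)) = real CARD('n) - real (card A)"
  for A :: "'n::finite set"
  using card_mono[of UNIV A] by (simp add: Compl_eq_Diff_UNIV card_Diff_subset of_nat_diff)

text \<open>Both sides count the pairs of a word \<open>c\<close> in \<open>M\<close> and a
  coordinate \<open>i\<close> in \<open>G\<close> with \<open>c $ i \<in> L i\<close>; on the right
  they are sorted by the symbol.\<close>

lemma card_agreements:
  fixes M :: "('b::finite^'n::finite) set"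
  shows "(\<Sum>c\<in>M. card {i \<in> G. c $ i \<in> L i}) = (\<Sum>i\<in>G. \<Sum>v\<in>L i. card {c \<in> M. c $ i = v})"
proof -
  have "(\<Sum>c\<in>M. card {i \<in> G. c $ i \<in> L i}) = (\<Sum>i\<in>G. card {c \<in> M. c $ i \<in> L i})"
    by (rule sum_multicount_gen) simp_all
  also have "\<dots> = (\<Sum>i\<in>G. \<Sum>v\<in>L i. card {c \<in> M. c $ i = v})"
  proof (rule sum.cong[OF refl])
    fix i
    have "{c \<in> M. c $ i \<in> L i} = (\<Union>v\<in>L i. {c \<in> M. c $ i = v})" by auto
    then show "card {c \<in> M. c $ i \<in> L i} = (\<Sum>v\<in>L i. card {c \<in> M. c $ i = v})"
      by (simp, subst card_UN_disjoint) auto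
  qed
  finally show ?thesis .
qed

text \<open>That \<open>M\<close> lies in one coset of \<open>A\<close> is expressed by differences,
  which needs no representative and passes to fibres. The threshold involves \<open>r\<close> and
  not \<open>word.dim A\<close>, so it stays fixed during the induction.\<close>

lemma card_list_in_coset:
  fixes A C M :: "('a::{field,finite}^'s::finite^'n::finite) set"
  assumes design: "subspace_design_code \<tau> C" and \<tau>: "0 \<le> \<tau> r" and r: "0 < r"
    and \<eta>: "0 < \<eta>" and h: "0 < h" "h < 1"
    and L: "\<And>i. card (L i) = l" and l: "0 < l"
    and "word.subspace A" "A \<subseteq> C" "word.dim A \<le> r"
    and "\<And>x y. x \<in> M \<Longrightarrow> y \<in> M \<Longrightarrow> x - y \<in> A"
    and "\<And>c. c \<in> M \<Longrightarrow> (\<tau> r + \<eta>) / (1 - h) * real CARD('n) < real (card {i. c $ i \<in> L i})"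
  shows "real (card M) \<le> real l powr list_exponent h (word.dim A) * (real (word.dim A) / \<eta> + 1)"
  using assms(9-)
proof (induction "word.dim A" arbitrary: A M rule: less_induct)
  case less
  define k where "k = word.dim A"
  define n where "n = real CARD('n)"
  define \<rho> where "\<rho> = (\<tau> r + \<eta>) / (1 - h)"
  show ?case
  proof (cases "k = 0")
    case True
    then have "A \<subseteq> {0}" using dim_word_eq_0 by (simp add: k_def)
    with less.prems(4) have "\<forall>x\<in>M. \<forall>y\<in>M. x = y" by fastforce
    then have "card M \<le> Suc 0" by (subst card_le_Suc0_iff_eq) auto
    \<comment> \<open>The exponent is 0, and \<open>real l powr 0 = 1\<close> requires
      \<open>0 < l\<close>.\<close>
    with True l h show ?thesis
      by (simp add: k_def[symmetric] list_exponent_small)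
  next
    case False
    define d where "d i = word.dim {a \<in> A. a $ i = 0}" for i
    define G where "G = {i. real (d i) \<le> (1 - h) * real k}"
    define b where "b = real (card (- G))"
    define E where "E = real l powr list_exponent h k"
    \<comment> \<open>Each word of \<open>M\<close> has at least \<open>P\<close> agreements with
      \<open>L\<close> inside \<open>G\<close>; \<open>k * Q\<close> bounds what the bad coordinates
      leave of the dimension sum.\<close>
    define P Q where "P = \<rho> * n - b" and "Q = \<tau> r * n - (1 - h) * b"
    have n: "0 < n" by (simp add: n_def)
    have E: "0 < E" using l by (simp add: E_def)
    have cardG: "real (card G) = n - b"
      by (simp add: b_def n_def card_Compl_real)
    have sum_d: "(\<Sum>i\<in>UNIV. real (d i)) \<le> real k * \<tau> r * n"
    proof -
      have "(\<Sum>i\<in>UNIV. real (d i)) / n \<le> real k * \<tau> r"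
        using design r less.prems unfolding subspace_design_code_def d_def k_def n_def by force
      with n show ?thesis by (simp add: field_simps)
    qed
    have sum_bad: "(1 - h) * real k * b \<le> (\<Sum>i\<in>-G. real (d i))"
    proof -
      have "(\<Sum>i\<in>-G. (1 - h) * real k) \<le> (\<Sum>i\<in>-G. real (d i))"
        by (rule sum_mono) (auto simp: G_def)
      then show ?thesis by (simp add: b_def mult.commute)
    qed
    have split: "(\<Sum>i\<in>UNIV. real (d i)) = (\<Sum>i\<in>G. real (d i)) + (\<Sum>i\<in>-G. real (d i))"
      by (subst sum.union_disjoint[symmetric]) auto
    have sum_good: "(\<Sum>i\<in>G. real (d i)) \<le> real k * Q"
      using sum_d sum_bad split by (simp add: Q_def algebra_simps)
    have "0 \<le> real k * Q"
      by (rule order_trans[OF _ sum_good]) (simp add: sum_nonneg)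
    with False have markov: "0 \<le> Q"
      by (simp add: zero_le_mult_iff)
    \<comment> \<open>The denominator \<open>1 - h\<close> of \<open>\<rho>\<close> cancels the
      Markov loss and leaves the gain \<open>\<eta> * n\<close>.\<close>
    have PQ: "(1 - h) * P = Q + \<eta> * n"
      using h by (simp add: P_def Q_def \<rho>_def field_simps)
    have "0 < (1 - h) * P"
      unfolding PQ using markov \<eta> n by (intro add_nonneg_pos) auto
    then have pos: "0 < P"
      using h by (simp add: zero_less_mult_iff)
    \<comment> \<open>The summands 1 contribute at most \<open>n \<le> k * n\<close>, which the gain
      \<open>\<eta> * n\<close> times \<open>k / \<eta>\<close> covers.\<close>
    have averaged: "(\<Sum>i\<in>G. real (d i) / \<eta> + 1) \<le> (real k / \<eta> + 1) * P"
    proof -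
      have "Q + \<eta> * n \<le> P"
        unfolding PQ[symmetric] using h pos by (simp add: mult_le_cancel_right1)
      then have "real k / \<eta> * (Q + \<eta> * n) \<le> real k / \<eta> * P"
        using \<eta> by (intro mult_left_mono) auto
      moreover have "real k / \<eta> * (Q + \<eta> * n)
          = real k * Q / \<eta> + real k * n"
        using \<eta> by (simp add: field_simps)
      moreover have "n \<le> real k * n"
        using False n by (simp add: mult_le_cancel_right1)
      moreover have "(\<Sum>i\<in>G. real (d i) / \<eta> + 1) = (\<Sum>i\<in>G. real (d i)) / \<eta> + (n - b)"
        by (simp add: sum.distrib cardG sum_divide_distrib)
      moreover have "(\<Sum>i\<in>G. real (d i)) / \<eta> \<le> real k * Q / \<eta>"
        using sum_good \<eta> by (simp add: divide_right_mono)
      moreover have "n - b \<le> n"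
        by (simp add: b_def)
      ultimately show ?thesis using pos unfolding distrib_right mult_1 by linarith
    qed
    have fibre: "real (card {c \<in> M. c $ i = v}) * real l \<le> E * (real (d i) / \<eta> + 1)"
      if i: "i \<in> G" for i v
    proof -
      have di: "real (d i) \<le> (1 - h) * real k" using i by (simp add: G_def)
      also have "\<dots> < real k" using h False by simp
      finally have dk: "d i < k" by simp
      \<comment> \<open>The fibre keeps the agreement hypothesis, and its differences vanish at
        \<open>i\<close>, so induction applies to the smaller space.\<close>
      have "real (card {c \<in> M. c $ i = v})
          \<le> real l powr list_exponent h (d i) * (real (d i) / \<eta> + 1)"
        unfolding d_def
        using less.prems dk
        by (intro less.hyps) (auto simp: d_def k_def intro: subspace_vanishing)
      then have "real (card {c \<in> M. c $ i = v}) * real l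
          \<le> real l powr list_exponent h (d i) * (real (d i) / \<eta> + 1) * real l"
        by (rule mult_right_mono) simp
      also have "\<dots> = real l powr (1 + list_exponent h (d i)) * (real (d i) / \<eta> + 1)"
        using l by (simp add: powr_add)
      also have "\<dots> \<le> E * (real (d i) / \<eta> + 1)"
        unfolding E_def using l \<eta> h False di
        by (intro mult_right_mono powr_mono list_exponent_step) auto
      finally show ?thesis .
    qed
    have "real (card M) * P = (\<Sum>c\<in>M. P)" by simp
    also have "\<dots> \<le> (\<Sum>c\<in>M. real (card {i \<in> G. c $ i \<in> L i}))"
    proof (rule sum_mono)
      fix c assume "c \<in> M"
      then have "\<rho> * n < real (card {i. c $ i \<in> L i})"
        using less.prems(5) by (simp add: \<rho>_def n_def)
      moreover have "card {i. c $ i \<in> L i} \<le> card {i \<in> G. c $ i \<in> L i} + card (- G)"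
        by (rule order_trans[OF card_mono card_Un_le]) auto
      ultimately show "P \<le> real (card {i \<in> G. c $ i \<in> L i})"
        by (simp add: P_def b_def)
    qed
    also have "\<dots> = (\<Sum>i\<in>G. \<Sum>v\<in>L i. real (card {c \<in> M. c $ i = v}))"
      using card_agreements[where M = M and G = G and L = L]
      by (simp flip: of_nat_sum)
    also have "\<dots> \<le> (\<Sum>i\<in>G. \<Sum>v\<in>L i. E * (real (d i) / \<eta> + 1) / real l)"
      using fibre l by (intro sum_mono) (simp add: field_simps)
    also have "\<dots> = E * (\<Sum>i\<in>G. real (d i) / \<eta> + 1)"
      using l by (simp add: L sum_distrib_left)
    also have "\<dots> \<le> E * ((real k / \<eta> + 1) * P)"
      using averaged E by (intro mult_left_mono) auto
    finally have "real (card M) * P \<le> E * (real k / \<eta> + 1) * P"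
      by (simp add: mult.assoc)
    then show ?thesis
      using pos by (simp add: E_def k_def)
  qed
qed

theorem theorem3p6:
  fixes \<tau> :: "nat \<Rightarrow> real"
    and C H :: "('a::{field,finite}^'s::finite^'n::finite) set"
    and L :: "'n \<Rightarrow> ('a^'s) set"
    and r l :: nat and \<eta> \<eta>' :: real
  assumes "r > 0" and "\<eta> > 0" and "0 < \<eta>'" and "\<eta>' < 1"
    and "\<forall>k\<ge>1. \<tau> k \<le> 1"
    and "additive_code C" and "subspace_design_code \<tau> C"
    and "\<forall>i. card (L i) = l"
    and "word.subspace H" and "H \<subseteq> C" and "word.dim H = r"
  shows "real (card {c \<in> H. frac_dist_set c (list_product L) < 1 - (\<tau> r + \<eta>) / (1 - \<eta>')})
    \<le> real l powr (min (real r) (1 / \<eta>' * (1 + ln_trunc (real r * \<eta>')))) * (real r / \<eta> + 1)"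
proof -
  define \<rho> where "\<rho> = (\<tau> r + \<eta>) / (1 - \<eta>')"
  define M where "M = {c \<in> H. frac_dist_set c (list_product L) < 1 - \<rho>}"
  have \<tau>: "0 \<le> \<tau> r"
    using subspace_design_nonneg[OF assms(7,9,10)] assms(1,11) by simp
  then have \<rho>: "0 \<le> \<rho>" using assms by (simp add: \<rho>_def)
  have dist: "frac_dist_set c (list_product L) = 1 - real (card {i. c $ i \<in> L i}) / real CARD('n)"
    for c
  proof -
    \<comment> \<open>Lists of equal size are all empty or all nonempty, as the distance formula
      requires.\<close>
    have "(\<forall>i. L i \<noteq> {}) \<or> (\<forall>i. L i = {})"
      using assms(8) by (metis card_0_eq finite)
    then have "frac_dist_set c (list_product L) = real (card (- {i. c $ i \<in> L i})) / real CARD('n)"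
      by (simp add: frac_dist_set_list_product Compl_eq)
    also have "\<dots> = 1 - real (card {i. c $ i \<in> L i}) / real CARD('n)"
      by (subst card_Compl_real) (simp add: diff_divide_distrib)
    finally show ?thesis .
  qed
  have agree: "\<rho> * real CARD('n) < real (card {i. c $ i \<in> L i})" if "c \<in> M" for c
    using that by (simp add: M_def dist field_simps)
  have "real (card M) \<le> real l powr list_exponent \<eta>' r * (real r / \<eta> + 1)"
  proof (cases "l = 0")
    case True
    then have "L i = {}" for i using assms(8) by (metis card_0_eq finite)
    \<comment> \<open>Without symbols to agree with, no word exceeds the nonnegative threshold; the
      claimed bound is 0 too, since \<open>0 powr x = 0\<close>.\<close>
    then have "M = {}" using agree \<rho> by (force simp: mult_less_0_iff)
    with True show ?thesis by simp
  next
    case False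
    have "x - y \<in> H" if "x \<in> M" "y \<in> M" for x y
      using that assms(9) by (simp add: M_def word.subspace_diff)
    with card_list_in_coset[OF assms(7) \<tau> assms(1-4), where L = L and l = l and A = H and M = M]
      assms(8-11) False agree
    show ?thesis by (simp add: \<rho>_def)
  qed
  then show ?thesis
    by (simp add: M_def \<rho>_def list_exponent_def)
qed

end
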